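(* Assume $g$ is the indicator function of a compact convex set (so $R_g=0$). Let $x^t$ be feasible, let $\delta_t\ge 0$, let $c>2$ and let $\tau_t:=\frac{\min\{\delta_t,(c-2)\theta\}}{c\theta}<1$. If $h^t$ is feasible for the linearized problem $\min_{h}F^{\mathrm{lin}}_{x^t}(h)$ and $$F^{\mathrm{lin}}_{x^t}(h^\star)\le F^{\mathrm{lin}}_{x^t}(h^t)\le(1-\tau_t)F^{\mathrm{lin}}_{x^t}(h^\star),$$ then at least one of the following two conditions is satisfied: (1) (large gap) $G_t^a>\theta+R_g$; (2) ($\delta_t$-suboptimality) $F^{\mathrm{lin}}_{x^t}(h^t)\le F^{\mathrm{lin}}_{x^t}(h^\star)+\delta_t$.
   Context: $\mathcal{K}\subset\mathbb{R}^d$ is a proper cone (closed, convex, pointed, nonempty interior). $f$ is a 2-self-concordant, $\theta$-logarithmically-homogeneous barrier on $\mathrm{int}(\mathcal{K})$: $f$ is strictly convex and $C^3$ on $\mathrm{int}(\mathcal{K})$; $f(w_i)\to\infty$ along every sequence in $\mathrm{int}(\mathcal{K})$ converging to a boundary point of $\mathcal{K}$; $|\nabla^3 f(w)[u,u,u]|\le 2(u^T\nabla^2 f(w)u)^{3/2}$ for all $w\in\mathrm{int}(\mathcal{K})$, $u\in\mathbb{R}^d$; and $f(cw)=f(w)-\theta\log c$ for $w\in\mathrm{int}(\mathcal{K})$, $c>0$. $\mathcal{B}:\mathbb{R}^n\to\mathbb{R}^d$ is linear with adjoint $\mathcal{B}^*$, and $\mathrm{int}(\mathcal{K})\cap\mathcal{B}(\mathrm{dom}(g))\ne\emptyset$.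 The problem is $\min_x F(x)=f(\mathcal{B}(x))+g(x)$; $x$ is feasible for it if $x\in\mathrm{dom}(g)$ and $\mathcal{B}(x)\in\mathrm{int}(\mathcal{K})$. $F^{\mathrm{lin}}_{x}(h)=\langle\mathcal{B}^*(\nabla f(\mathcal{B}(x))),h\rangle+g(h)$; $h$ is feasible for the linearized problem if $h\in\mathrm{dom}(g)$; $h^\star$ is a minimizer of $F^{\mathrm{lin}}_{x^t}$. $G_t^a=F^{\mathrm{lin}}_{x^t}(x^t)-F^{\mathrm{lin}}_{x^t}(h^t)$. $R_g=\max_{x_1,x_2\in\mathrm{dom}(g)}|g(x_1)-g(x_2)|$. *)

theory Defs
  imports "HOL-Analysis.Analysis"
begin

definition proper_cone :: "(real ^ 'd) set \<Rightarrow> bool" where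
  "proper_cone K \<longleftrightarrow>
     cone K \<and> closed K \<and> convex K \<and> (\<forall>x. x \<in> K \<and> - x \<in> K \<longrightarrow> x = 0) \<and> interior K \<noteq> {}"

definition strictly_convex_on :: "'a::real_vector set \<Rightarrow> ('a \<Rightarrow> real) \<Rightarrow> bool" where
  "strictly_convex_on S f \<longleftrightarrow>
     convex S \<and>
     (\<forall>x\<in>S. \<forall>y\<in>S. \<forall>t. x \<noteq> y \<and> 0 < t \<and> t < 1 \<longrightarrow>
        f ((1 - t) *\<^sub>R x + t *\<^sub>R y) < (1 - t) * f x + t * f y)"

(* Intended for open S in a finite-dimensional space: all directional-derivative
   fields up to order k - 1 are differentiable and those of order k are continuous. *)
primrec C_k_on :: "nat \<Rightarrow> ('a::euclidean_space \<Rightarrow> real) \<Rightarrow> 'a set \<Rightarrow> bool" where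
  "C_k_on 0 f S \<longleftrightarrow> continuous_on S f"
| "C_k_on (Suc k) f S \<longleftrightarrow>
     f differentiable_on S \<and> (\<forall>u. C_k_on k (\<lambda>w. frechet_derivative f (at w) u) S)"

definition grad :: "(real ^ 'd \<Rightarrow> real) \<Rightarrow> real ^ 'd \<Rightarrow> real ^ 'd" where
  "grad f w = (THE D. GDERIV f w :> D)"

definition hessian :: "(real ^ 'd \<Rightarrow> real) \<Rightarrow> real ^ 'd \<Rightarrow> real ^ 'd ^ 'd" where
  "hessian f w = jacobian (grad f) (at w)"

definition third_deriv ::
    "(real ^ 'd \<Rightarrow> real) \<Rightarrow> real ^ 'd \<Rightarrow> real ^ 'd \<Rightarrow> real ^ 'd \<Rightarrow> real ^ 'd \<Rightarrow> real" where
  "third_deriv f w u v z =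
     frechet_derivative
       (\<lambda>p. frechet_derivative (\<lambda>q. frechet_derivative f (at q) z) (at p) v) (at w) u"

(* The function f is total, but only its values on the interior of K are constrained
   or used; the value plus infinity outside is left implicit. *)
definition barrier_on :: "(real ^ 'd) set \<Rightarrow> (real ^ 'd \<Rightarrow> real) \<Rightarrow> bool" where
  "barrier_on K f \<longleftrightarrow>
     (\<forall>w b. (\<forall>i. w i \<in> interior K) \<and> w \<longlonglongrightarrow> b \<and> b \<in> frontier K \<longrightarrow>
        filterlim (\<lambda>i. f (w i)) at_top sequentially)"

definition two_self_concordant_on :: "(real ^ 'd) set \<Rightarrow> (real ^ 'd \<Rightarrow> real) \<Rightarrow> bool" where
  "two_self_concordant_on K f \<longleftrightarrow>
     (\<forall>w\<in>interior K. \<forall>u.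
        \<bar>third_deriv f w u u u\<bar> \<le> 2 * (u \<bullet> (hessian f w *v u)) powr (3 / 2))"

definition log_homogeneous_on ::
    "real \<Rightarrow> (real ^ 'd) set \<Rightarrow> (real ^ 'd \<Rightarrow> real) \<Rightarrow> bool" where
  "log_homogeneous_on \<theta> K f \<longleftrightarrow>
     (\<forall>w\<in>interior K. \<forall>c>0. f (c *\<^sub>R w) = f w - \<theta> * ln c)"

definition self_concordant_log_hom_barrier ::
    "real \<Rightarrow> (real ^ 'd) set \<Rightarrow> (real ^ 'd \<Rightarrow> real) \<Rightarrow> bool" where
  "self_concordant_log_hom_barrier \<theta> K f \<longleftrightarrow>
     strictly_convex_on (interior K) f \<and> C_k_on 3 f (interior K) \<and>
     barrier_on K f \<and> two_self_concordant_on K f \<and> log_homogeneous_on \<theta> K f"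

definition eff_dom :: "('a \<Rightarrow> ereal) \<Rightarrow> 'a set" where
  "eff_dom g = {x. g x < \<infinity>}"

definition convex_indicator :: "'a set \<Rightarrow> 'a \<Rightarrow> ereal" where
  "convex_indicator D x = (if x \<in> D then 0 else \<infinity>)"

definition feasible ::
    "(real ^ 'd) set \<Rightarrow> (real ^ 'n \<Rightarrow> real ^ 'd) \<Rightarrow> (real ^ 'n \<Rightarrow> ereal) \<Rightarrow> real ^ 'n \<Rightarrow> bool" where
  "feasible K B g x \<longleftrightarrow> x \<in> eff_dom g \<and> B x \<in> interior K"

definition F_lin ::
    "(real ^ 'd \<Rightarrow> real) \<Rightarrow> (real ^ 'n \<Rightarrow> real ^ 'd) \<Rightarrow> (real ^ 'n \<Rightarrow> ereal) \<Rightarrow>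
     real ^ 'n \<Rightarrow> real ^ 'n \<Rightarrow> ereal" where
  "F_lin f B g x h = ereal (adjoint B (grad f (B x)) \<bullet> h) + g h"

definition lin_feasible :: "(real ^ 'n \<Rightarrow> ereal) \<Rightarrow> real ^ 'n \<Rightarrow> bool" where
  "lin_feasible g h \<longleftrightarrow> h \<in> eff_dom g"

definition approx_gap ::
    "(real ^ 'd \<Rightarrow> real) \<Rightarrow> (real ^ 'n \<Rightarrow> real ^ 'd) \<Rightarrow> (real ^ 'n \<Rightarrow> ereal) \<Rightarrow>
     real ^ 'n \<Rightarrow> real ^ 'n \<Rightarrow> ereal" where
  "approx_gap f B g x h = F_lin f B g x x - F_lin f B g x h"

(* The maximum, whenever it is attained. *)
definition R_max :: "('a \<Rightarrow> ereal) \<Rightarrow> ereal" where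
  "R_max g = (SUP p \<in> eff_dom g \<times> eff_dom g. \<bar>g (fst p) - g (snd p)\<bar>)"

end

theory Submission
  imports Defs
begin

text \<open>
  Since \<open>f\<close> is \<open>\<theta>\<close>-logarithmically homogeneous, Euler's identity
  \<open>grad f w \<bullet> w = - \<theta>\<close> makes the linearized objective \<open>L\<close> equal to \<open>- \<theta>\<close> at the
  current iterate, and strict convexity along a ray forces \<open>\<theta> > 0\<close>. If \<open>h\<close> is not
  \<open>\<delta>\<close>-suboptimal, then the relative accuracy bound gives \<open>- \<tau> * L hstar > \<delta>\<close>,
  so \<open>L hstar < - c * \<theta>\<close> because \<open>\<tau> \<le> \<delta> / (c * \<theta>)\<close>, and then
  \<open>L h < - (1 - \<tau>) * c * \<theta> \<le> - 2 * \<theta>\<close> because \<open>\<tau> \<le> (c - 2) / c\<close>.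
\<close>

text \<open>\<open>grad\<close> is a definite description, so a witness and its uniqueness are both
  needed: the derivative is a linear functional, represented by \<open>adjoint f' 1\<close>, and
  derivatives are unique.\<close>

lemma GDERIV_grad:
  assumes "f differentiable (at w)"
  shows "GDERIV f w :> grad f w"
proof -
  obtain f' where f': "(f has_derivative f') (at w)"
    using assms by (auto simp: differentiable_def)
  have "f' v = v \<bullet> adjoint f' 1" for v
    using adjoint_works[OF has_derivative_linear[OF f'], of v 1] by simp
  then have "f' = (\<lambda>v. v \<bullet> adjoint f' 1)"
    by blast
  then have ex: "GDERIV f w :> adjoint f' 1"
    using f' unfolding gderiv_def by simp
  have "D = E" if "GDERIV f w :> D" "GDERIV f w :> E" for D E
  proof -
    have "(\<lambda>v. v \<bullet> D) = (\<lambda>v. v \<bullet> E)"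
      using that unfolding gderiv_def by (rule has_derivative_unique)
    then show ?thesis
      by (metis vector_eq_ldot)
  qed
  then show ?thesis
    unfolding grad_def using theI[of "\<lambda>D. GDERIV f w :> D", OF ex] ex by metis
qed

text \<open>Differentiate \<open>f (t *\<^sub>R w)\<close> in \<open>t\<close> at 1 twice: by the
  chain rule and from the logarithmic formula.\<close>

lemma log_homogeneous_euler:
  assumes "log_homogeneous_on \<theta> K f" "w \<in> interior K" "f differentiable (at w)"
  shows "grad f w \<bullet> w = - \<theta>"
proof -
  have "(f has_derivative (\<lambda>v. v \<bullet> grad f w)) (at (1 *\<^sub>R w))"
    using GDERIV_grad[OF assms(3)] by (simp add: gderiv_def)
  then have "((\<lambda>t. f (t *\<^sub>R w)) has_derivative (\<lambda>t. (t *\<^sub>R w) \<bullet> grad f w)) (at 1)"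
    by (rule has_derivative_compose[rotated]) (auto intro!: derivative_eq_intros)
  then have ray: "((\<lambda>t. f (t *\<^sub>R w)) has_real_derivative grad f w \<bullet> w) (at 1)"
    by (rule has_derivative_imp_has_field_derivative) (simp add: inner_commute)
  have "((\<lambda>t. f w - \<theta> * ln t) has_real_derivative - \<theta>) (at 1)"
    by (auto intro!: derivative_eq_intros)
  \<comment> \<open>The formula is given for \<open>t > 0\<close> only; agreement near 1 suffices
    for the derivative.\<close>
  moreover have "\<forall>\<^sub>F t in nhds 1. f (t *\<^sub>R w) = f w - \<theta> * ln t"
    using assms(1,2) eventually_nhds_in_open[of "{0<..}" "1::real"]
    by (auto simp: log_homogeneous_on_def elim!: eventually_mono)
  ultimately have "((\<lambda>t. f (t *\<^sub>R w)) has_real_derivative - \<theta>) (at 1)"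
    using DERIV_cong_ev[OF refl _ refl] by fast
  with ray show ?thesis
    by (rule DERIV_unique)
qed

lemma cone_interior_scaleR:
  fixes K :: "'a::euclidean_space set"
  assumes "cone K" "w \<in> interior K" "c > 0"
  shows "c *\<^sub>R w \<in> interior K"
proof (rule interiorI)
  show "open ((*\<^sub>R) c ` interior K)"
    using assms(3) by (intro open_scaling) auto
  show "(*\<^sub>R) c ` interior K \<subseteq> K"
    using assms(1,3) interior_subset by (force simp: cone_def)
qed (use assms(2) in blast)

text \<open>Strict convexity at the midpoint \<open>2w\<close> of \<open>w\<close> and
  \<open>3w\<close> reads \<open>\<theta> * (2 * ln 2 - ln 3) > 0\<close>, and
  \<open>3 < 2^2\<close>.\<close>

lemma log_homogeneous_parameter_pos:
  assumes "cone K" "interior K \<noteq> {}"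
    and "strictly_convex_on (interior K) f" "log_homogeneous_on \<theta> K f"
  shows "\<theta> > 0"
proof -
  \<comment> \<open>A nonzero \<open>w\<close> is required to make \<open>w\<close> and
    \<open>3w\<close> distinct.\<close>
  have "interior K \<noteq> {0}"
    using not_open_singleton open_interior by metis
  then obtain w where w: "w \<in> interior K" "w \<noteq> 0"
    using assms(2) by blast
  have mem: "2 *\<^sub>R w \<in> interior K" "3 *\<^sub>R w \<in> interior K"
    using cone_interior_scaleR[OF assms(1) w(1)] by simp_all
  have "f ((1 - 1/2) *\<^sub>R w + (1/2) *\<^sub>R (3 *\<^sub>R w)) < (1 - 1/2) * f w + (1/2) * f (3 *\<^sub>R w)"
  proof -
    have "w \<noteq> 3 *\<^sub>R w"
      using w(2) scaleR_cancel_right[of 1 w 3] by simp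
    moreover have "0 < (1/2::real) \<and> (1/2::real) < 1"
      by simp
    ultimately show ?thesis
      using assms(3) w(1) mem(2) unfolding strictly_convex_on_def by blast
  qed
  moreover have "(1 - 1/2) *\<^sub>R w + (1/2) *\<^sub>R (3 *\<^sub>R w) = 2 *\<^sub>R w"
    by (simp flip: scaleR_add_left)
  moreover have "f (2 *\<^sub>R w) = f w - \<theta> * ln 2" "f (3 *\<^sub>R w) = f w - \<theta> * ln 3"
    using assms(4) w(1) by (auto simp: log_homogeneous_on_def)
  ultimately have "0 < \<theta> * (2 * ln 2 - ln 3)"
    by (simp add: algebra_simps)
  moreover have "ln 3 < 2 * ln (2::real)"
    using ln_realpow[of "2::real" 2] ln_less_cancel_iff[of "3::real" 4] by simp
  ultimately show ?thesis
    by (simp add: zero_less_mult_iff)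
qed

text \<open>The bound is \<open>- 2 * \<theta>\<close> because the iterate has value
  \<open>- \<theta>\<close>, which leaves a gap above \<open>\<theta>\<close>.\<close>

lemma relative_accuracy_large_gap:
  fixes L Lmin \<theta> \<delta> c \<tau> :: real
  assumes "\<theta> > 0" "\<delta> \<ge> 0" "c > 2"
    and \<tau>: "\<tau> = min \<delta> ((c - 2) * \<theta>) / (c * \<theta>)"
    and "L \<le> (1 - \<tau>) * Lmin" "Lmin + \<delta> < L"
  shows "L < - 2 * \<theta>"
proof -
  have c\<theta>: "c * \<theta> > 0" and \<tau>0: "\<tau> \<ge> 0"
    using assms(1-3) \<tau> by auto
  have \<tau>_eq: "\<tau> * (c * \<theta>) = min \<delta> ((c - 2) * \<theta>)"
    unfolding \<tau> using c\<theta> by (intro nonzero_eq_divide_eq[THEN iffD1, OF _ refl]) linarith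
  \<comment> \<open>Chaining \<open>Lmin + \<delta> < L \<le> (1 - \<tau>) * Lmin\<close> gives
    \<open>\<delta> < - \<tau> * Lmin\<close>, and the left side here is at most
    \<open>\<delta>\<close>.\<close>
  have "\<tau> * (c * \<theta>) < \<tau> * - Lmin"
    using assms(5,6) \<tau>_eq by (simp add: algebra_simps)
  then have Lmin: "Lmin < - (c * \<theta>)"
    using \<tau>0 mult_less_cancel_left by fastforce
  have "\<tau> * (c * \<theta>) < 1 * (c * \<theta>)"
    using \<tau>_eq assms(1) by (simp add: algebra_simps)
  then have "\<tau> < 1"
    using c\<theta> mult_less_cancel_right_pos by blast
  then have "(1 - \<tau>) * Lmin < (1 - \<tau>) * - (c * \<theta>)"
    using Lmin by (intro mult_strict_left_mono) auto
  \<comment> \<open>Here the other argument of the minimum is used: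
    \<open>\<tau> * (c * \<theta>) \<le> (c - 2) * \<theta>\<close>.\<close>
  also have "\<dots> \<le> - 2 * \<theta>"
    using \<tau>_eq by (simp add: algebra_simps)
  finally show ?thesis
    using assms(5) by simp
qed

theorem lemma9:
  fixes K :: "(real ^ 'd) set"
    and f :: "real ^ 'd \<Rightarrow> real"
    and \<theta> :: real
    and B :: "real ^ 'n \<Rightarrow> real ^ 'd"
    and g :: "real ^ 'n \<Rightarrow> ereal"
    and D :: "(real ^ 'n) set"
    and x h hstar :: "real ^ 'n"
    and \<delta> c \<tau> :: real
  assumes "proper_cone K"
    and "self_concordant_log_hom_barrier \<theta> K f"
    and "linear B"
    and "interior K \<inter> B ` eff_dom g \<noteq> {}"
    and "compact D" and "convex D" and "g = convex_indicator D"
    and "feasible K B g x"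
    and "\<delta> \<ge> 0" and "c > 2"
    and "\<tau> = min \<delta> ((c - 2) * \<theta>) / (c * \<theta>)"
    and "is_arg_min (F_lin f B g x) (lin_feasible g) hstar"
    and "lin_feasible g h"
    and "F_lin f B g x hstar \<le> F_lin f B g x h"
    and "F_lin f B g x h \<le> ereal (1 - \<tau>) * F_lin f B g x hstar"
  shows "approx_gap f B g x h > ereal \<theta> + R_max g \<or>
         F_lin f B g x h \<le> F_lin f B g x hstar + ereal \<delta>"
proof (cases "F_lin f B g x h \<le> F_lin f B g x hstar + ereal \<delta>")
  case False
  have dom: "eff_dom g = D"
    using assms(7) by (auto simp: eff_dom_def convex_indicator_def)
  have mem: "x \<in> D" "h \<in> D" "hstar \<in> D" and Bx: "B x \<in> interior K"
    using assms(8,12,13) dom by (auto simp: feasible_def is_arg_min_def lin_feasible_def)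
  \<comment> \<open>On \<open>D\<close> the indicator vanishes, so the extended-real inequalities
    become real ones about \<open>L\<close>.\<close>
  define L where "L y = adjoint B (grad f (B x)) \<bullet> y" for y
  have F: "F_lin f B g x y = ereal (L y)" if "y \<in> D" for y
    using that assms(7) by (simp add: F_lin_def L_def convex_indicator_def)
  have "interior K \<noteq> {}"
    using Bx by blast
  then have "\<theta> > 0"
    using assms(1,2) log_homogeneous_parameter_pos
    by (auto simp: proper_cone_def self_concordant_log_hom_barrier_def)
  moreover have "L h \<le> (1 - \<tau>) * L hstar" "L hstar + \<delta> < L h"
    using assms(15) False F mem by auto
  ultimately have "L h < - 2 * \<theta>"
    using relative_accuracy_large_gap assms(9-11) by blast
  moreover have "L x = - \<theta>"
  proof -
    have "f differentiable_on interior K"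
      using assms(2) by (simp add: self_concordant_log_hom_barrier_def numeral_3_eq_3)
    then have "f differentiable (at (B x))"
      using Bx by (simp add: differentiable_on_eq_differentiable_at)
    then have "grad f (B x) \<bullet> B x = - \<theta>"
      using assms(2) Bx log_homogeneous_euler
      by (auto simp: self_concordant_log_hom_barrier_def)
    then show ?thesis
      unfolding L_def using adjoint_works[OF assms(3), of x "grad f (B x)"]
      by (simp add: inner_commute)
  qed
  moreover have "R_max g = 0"
  proof -
    \<comment> \<open>Since \<open>x\<close> lies in \<open>D\<close>, the supremum is not over the
      empty set, where it would be minus infinity.\<close>
    have "(\<lambda>p. \<bar>g (fst p) - g (snd p)\<bar>) ` (D \<times> D) = {0}"
      using mem(1) assms(7) by (force simp: convex_indicator_def)
    then show ?thesis
      by (simp add: R_max_def dom)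
  qed
  ultimately show ?thesis
    using F mem by (simp add: approx_gap_def)
qed simp

end
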